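(* Let $n\ge1$ and let $K$ be a pure $n$-simplicial complex. Then $K$ is connected if and only if $K$ has an $(n-1)$-ordering.
   Context: A simplicial complex on a finite vertex set is a collection of non-empty vertex subsets containing all singletons and closed under non-empty subsets; a $k$-simplex has $k+1$ vertices; $\tau$ is a face of $\sigma$ if $\tau\subseteq\sigma$. $K$ is a pure $n$-simplicial complex if $\dim K=n$ and every simplex is a face of some $n$-simplex. For a set $S$ of simplices, $\overline{S}$ is the set of all faces of members of $S$. An $(n-1,n)$-walk sequence is an alternating sequence $\sigma_1,\eta_1,\sigma_2,\dots,\sigma_r,\eta_r,\sigma_{r+1}$ of $(n-1)$-simplices $\sigma_k$ and $n$-simplices $\eta_k$ with $\sigma_k\ne\sigma_{k+1}$ both faces of $\eta_k$; it is an $(n-1,n)$-path sequence if all its simplices are distinct. $K$ is connected if there is an $(n-1,n)$-path sequence between every pair of distinct $(n-1)$-simplices. For an $n$-simplex $\eta$ of a pure $n$-simplicial complex $L$, the attachment $\mathcal{A}(\eta,L)$ is the subcomplex of all faces of $\eta$ that are also faces of some $n$-simplex of $L$ other than $\eta$. $K$ has an $(n-1)$-ordering if its $n$-simplices can be listed, each exactly once, as $\eta_1,\dots,\eta_t$ ($t$ the number of $n$-simplices) such that for each $2\le i\le t$, with $K_i=\overline{\{\eta_1,\dots,\eta_i\}}$, the attachment $\mathcal{A}(\eta_i,K_i)$ is an $(n-1)$-dimensional simplicial complex. *)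

theory Defs
  imports Main
begin

definition simplicial_complex :: "'a set \<Rightarrow> 'a set set \<Rightarrow> bool" where
  "simplicial_complex V K \<longleftrightarrow>
     finite V \<and>
     (\<forall>\<sigma>\<in>K. \<sigma> \<noteq> {} \<and> \<sigma> \<subseteq> V) \<and>
     (\<forall>v\<in>V. {v} \<in> K) \<and>
     (\<forall>\<sigma>\<in>K. \<forall>\<tau>. \<tau> \<noteq> {} \<and> \<tau> \<subseteq> \<sigma> \<longrightarrow> \<tau> \<in> K)"

definition simplices :: "nat \<Rightarrow> 'a set set \<Rightarrow> 'a set set" where
  "simplices k K = {\<sigma> \<in> K. card \<sigma> = k + 1}"

text \<open>The dimension is integer-valued; the empty complex has dimension \<open>-1\<close>.\<close>

definition complex_dim :: "'a set set \<Rightarrow> int" where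
  "complex_dim K = (if K = {} then - 1 else Max ((\<lambda>\<sigma>. int (card \<sigma>) - 1) ` K))"

definition pure_complex :: "nat \<Rightarrow> 'a set \<Rightarrow> 'a set set \<Rightarrow> bool" where
  "pure_complex n V K \<longleftrightarrow>
     simplicial_complex V K \<and> complex_dim K = int n \<and>
     (\<forall>\<sigma>\<in>K. \<exists>\<eta>\<in>simplices n K. \<sigma> \<subseteq> \<eta>)"

definition face_closure :: "'a set set \<Rightarrow> 'a set set" where
  "face_closure S = {\<tau>. \<tau> \<noteq> {} \<and> (\<exists>\<sigma>\<in>S. \<tau> \<subseteq> \<sigma>)}"

text \<open>
  A sequence \<open>\<sigma>\<^sub>1, \<eta>\<^sub>1, \<sigma>\<^sub>2, \<dots>, \<sigma>\<^sub>r, \<eta>\<^sub>r, \<sigma>\<^sub>r\<^sub>+\<^sub>1\<close> is given by the list \<open>ss\<close> of the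
  \<open>\<sigma>\<^sub>k\<close> and the list \<open>es\<close> of the \<open>\<eta>\<^sub>k\<close>. The natural number \<open>n - 1\<close> is only
  meaningful for \<open>n \<ge> 1\<close>.
\<close>

definition walk_seq :: "nat \<Rightarrow> 'a set set \<Rightarrow> 'a set list \<Rightarrow> 'a set list \<Rightarrow> bool" where
  "walk_seq n K ss es \<longleftrightarrow>
     es \<noteq> [] \<and> length ss = length es + 1 \<and>
     set ss \<subseteq> simplices (n - 1) K \<and> set es \<subseteq> simplices n K \<and>
     (\<forall>k < length es. ss ! k \<noteq> ss ! (k + 1) \<and> ss ! k \<subseteq> es ! k \<and> ss ! (k + 1) \<subseteq> es ! k)"

definition path_seq :: "nat \<Rightarrow> 'a set set \<Rightarrow> 'a set list \<Rightarrow> 'a set list \<Rightarrow> bool" where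
  "path_seq n K ss es \<longleftrightarrow> walk_seq n K ss es \<and> distinct (ss @ es)"

definition connected_complex :: "nat \<Rightarrow> 'a set set \<Rightarrow> bool" where
  "connected_complex n K \<longleftrightarrow>
     (\<forall>\<sigma>\<in>simplices (n - 1) K. \<forall>\<tau>\<in>simplices (n - 1) K. \<sigma> \<noteq> \<tau> \<longrightarrow>
        (\<exists>ss es. path_seq n K ss es \<and> hd ss = \<sigma> \<and> last ss = \<tau>))"

definition attachment :: "nat \<Rightarrow> 'a set \<Rightarrow> 'a set set \<Rightarrow> 'a set set" where
  "attachment n \<eta> L =
     {\<tau>. \<tau> \<noteq> {} \<and> \<tau> \<subseteq> \<eta> \<and> (\<exists>\<eta>'\<in>simplices n L. \<eta>' \<noteq> \<eta> \<and> \<tau> \<subseteq> \<eta>')}"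

text \<open>Lists are indexed from 0, so \<open>\<eta>\<^sub>i\<close> is \<open>es ! (i - 1)\<close> and
  \<open>\<eta>\<^sub>1, \<dots>, \<eta>\<^sub>i\<close> are the members of \<open>take i es\<close>.\<close>

definition has_ordering :: "nat \<Rightarrow> 'a set set \<Rightarrow> bool" where
  "has_ordering n K \<longleftrightarrow>
     (\<exists>es. distinct es \<and> set es = simplices n K \<and>
        (\<forall>i. 2 \<le> i \<and> i \<le> length es \<longrightarrow>
           (let A = attachment n (es ! (i - 1)) (face_closure (set (take i es)))
            in simplicial_complex (\<Union>A) A \<and> complex_dim A = int n - 1)))"

end

theory Submission
  imports Defs
begin

text \<open>
  Call two \<open>n\<close>-simplices adjacent if they are distinct and share an \<open>(n-1)\<close>-simplex. Both
  connectedness and the existence of an \<open>(n-1)\<close>-ordering are equivalent to the statement that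
  every partition of the set of \<open>n\<close>-simplices into two non-empty parts is crossed by an adjacent
  pair. Indeed, an \<open>(n-1)\<close>-ordering is a listing in which every \<open>n\<close>-simplex but the first is
  adjacent to an earlier one: it can be built greedily from crossing pairs, and conversely the
  first member of the list on the other side of the partition yields a crossing pair.
\<close>

section \<open>Connectivity by cuts and by attaching lists\<close>

definition shares_facet :: "nat \<Rightarrow> 'a set \<Rightarrow> 'a set \<Rightarrow> bool" where
  "shares_facet n \<eta> \<eta>' \<longleftrightarrow> \<eta> \<noteq> \<eta>' \<and> (\<exists>\<sigma>. card \<sigma> = n \<and> \<sigma> \<subseteq> \<eta> \<and> \<sigma> \<subseteq> \<eta>')"

definition cut_connected :: "('b \<Rightarrow> 'b \<Rightarrow> bool) \<Rightarrow> 'b set \<Rightarrow> bool" where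
  "cut_connected r F \<longleftrightarrow> (\<forall>S. S \<subseteq> F \<and> S \<noteq> {} \<and> S \<noteq> F \<longrightarrow> (\<exists>x\<in>S. \<exists>y\<in>F - S. r x y))"

text \<open>Indices start at 0, so position \<open>j\<close> holds the simplex numbered
  \<open>j + 1\<close> in an ordering; the exempt position 0 is the first simplex.\<close>

definition attaching_list :: "('b \<Rightarrow> 'b \<Rightarrow> bool) \<Rightarrow> 'b list \<Rightarrow> bool" where
  "attaching_list r xs \<longleftrightarrow> (\<forall>j. 1 \<le> j \<and> j < length xs \<longrightarrow> (\<exists>k<j. r (xs ! k) (xs ! j)))"

lemma shares_facet_sym: "shares_facet n x y \<Longrightarrow> shares_facet n y x"
  unfolding shares_facet_def by blast

lemma attaching_list_imp_cut_connected:
  assumes att: "attaching_list r xs" and sym: "\<And>x y. r x y \<Longrightarrow> r y x"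
  shows "cut_connected r (set xs)"
  unfolding cut_connected_def
proof (intro allI impI, elim conjE)
  fix S assume S: "S \<subseteq> set xs" "S \<noteq> {}" "S \<noteq> set xs"
  \<comment> \<open>Sides are compared with that of entry 0, not with \<open>S\<close>, so one
    minimality argument serves whether or not the list starts in \<open>S\<close>.\<close>
  define P where "P j \<longleftrightarrow> j < length xs \<and> (xs ! j \<in> S) \<noteq> (xs ! 0 \<in> S)" for j
  obtain a where a: "a < length xs" "xs ! a \<in> S"
    using S by (metis all_not_in_conv in_set_conv_nth subsetD)
  obtain b where b: "b < length xs" "xs ! b \<notin> S"
    using S by (metis in_set_conv_nth subsetI subset_antisym)
  have "\<exists>j. P j" using a b unfolding P_def by blast
  then obtain j where j: "P j" and least: "\<And>k. k < j \<Longrightarrow> \<not> P k"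
    by (metis LeastI_ex not_less_Least)
  have "1 \<le> j" using j unfolding P_def by (cases j) auto
  then obtain k where k: "k < j" "r (xs ! k) (xs ! j)"
    using att j unfolding attaching_list_def P_def by blast
  have len: "k < length xs" "j < length xs" using k j by (auto simp: P_def)
  have "(xs ! k \<in> S) \<noteq> (xs ! j \<in> S)" using least[OF k(1)] j len unfolding P_def by blast
  \<comment> \<open>If entry 0 lies outside \<open>S\<close>, the pair found leads from the
    complement into \<open>S\<close>; symmetry reverses it.\<close>
  then show "\<exists>x\<in>S. \<exists>y\<in>set xs - S. r x y"
    using k(2) sym len by (metis Diff_iff nth_mem)
qed

text \<open>A list shorter than \<open>card F\<close> has a proper subset of \<open>F\<close> as its
  set of entries, so the cut supplies a new element related to one of them. Induction on the length
  ends when \<open>F\<close> is exhausted.\<close>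

lemma cut_connected_imp_attaching_list:
  assumes fin: "finite F" and cut: "cut_connected r F"
  shows "\<exists>xs. distinct xs \<and> set xs = F \<and> attaching_list r xs"
proof (cases "F = {}")
  case True
  then show ?thesis by (simp add: attaching_list_def)
next
  case False
  have "\<exists>xs. distinct xs \<and> set xs \<subseteq> F \<and> length xs = m \<and> attaching_list r xs" if "m \<le> card F" for m
    using that
  proof (induction m)
    case 0
    then show ?case by (simp add: attaching_list_def)
  next
    case (Suc m)
    then obtain xs where xs: "distinct xs" "set xs \<subseteq> F" "length xs = m" "attaching_list r xs"
      by auto
    show ?case
    \<comment> \<open>The cut condition says nothing about an empty side, so the first element is
      chosen freely.\<close>
    proof (cases "xs = []")
      case True
      obtain x where "x \<in> F" using False by blast
      then show ?thesis using True xs by (intro exI[of _ "[x]"]) (auto simp: attaching_list_def)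
    next
      case ne: False
      have "set xs \<noteq> F" using Suc.prems xs distinct_card by fastforce
      then obtain x y where xy: "x \<in> set xs" "y \<in> F - set xs" "r x y"
        using cut xs(2) ne unfolding cut_connected_def by (metis set_empty)
      have "attaching_list r (xs @ [y])"
        unfolding attaching_list_def
      proof (intro allI impI, elim conjE)
        fix j assume j: "1 \<le> j" "j < length (xs @ [y])"
        show "\<exists>k<j. r ((xs @ [y]) ! k) ((xs @ [y]) ! j)"
        proof (cases "j < length xs")
          case True
          then obtain k where "k < j" "r (xs ! k) (xs ! j)"
            using xs(4) j unfolding attaching_list_def by blast
          then show ?thesis using True by (intro exI[of _ k]) (simp add: nth_append)
        next
          case False
          then have "j = length xs" using j by simp
          moreover obtain k where "k < length xs" "xs ! k = x"
            using xy(1) by (auto simp: in_set_conv_nth)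
          ultimately show ?thesis using xy(3) by (auto simp: nth_append)
        qed
      qed
      then show ?thesis using xs xy by (intro exI[of _ "xs @ [y]"]) auto
    qed
  qed
  then obtain xs where "distinct xs" "set xs \<subseteq> F" "length xs = card F" "attaching_list r xs"
    by blast
  then show ?thesis using fin by (metis card_subset_eq distinct_card)
qed

section \<open>Attachments and orderings\<close>

text \<open>A face with as many vertices as the finite simplex containing it equals that simplex.
  Hence forming \<open>face_closure\<close> of list entries adds no new
  \<open>n\<close>-simplices.\<close>

lemma simplices_face_closure:
  assumes "\<And>\<eta>. \<eta> \<in> S \<Longrightarrow> card \<eta> = n + 1"
  shows "simplices n (face_closure S) = S"
proof
  show "simplices n (face_closure S) \<subseteq> S"
  proof
    fix \<tau> assume "\<tau> \<in> simplices n (face_closure S)"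
    then obtain \<sigma> where "\<sigma> \<in> S" "\<tau> \<subseteq> \<sigma>" "card \<tau> = n + 1"
      unfolding simplices_def face_closure_def by blast
    \<comment> \<open>Infinite sets have \<open>card\<close> 0, so the positive size
      \<open>n + 1\<close> forces finiteness.\<close>
    moreover from this have "finite \<sigma>" using assms by (metis add_is_0 card.infinite one_neq_zero)
    ultimately show "\<tau> \<in> S" using assms by (metis card_subset_eq)
  qed
  show "S \<subseteq> simplices n (face_closure S)"
    using assms unfolding simplices_def face_closure_def by fastforce
qed

lemma simplicial_complex_attachment:
  assumes "finite \<eta>"
  shows "simplicial_complex (\<Union> (attachment n \<eta> L)) (attachment n \<eta> L)"
  unfolding simplicial_complex_def
proof (intro conjI ballI allI impI)
  show "finite (\<Union> (attachment n \<eta> L))"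
    using assms by (rule finite_subset[rotated]) (auto simp: attachment_def)
qed (auto simp: attachment_def)

text \<open>Distinct sets of equal finite size do not contain each other, so every face in the
  attachment has at most \<open>n\<close> vertices. Dimension \<open>n - 1\<close> is therefore the
  upper bound, attained exactly when some shared face has \<open>n\<close> vertices.\<close>

lemma complex_dim_attachment_iff:
  fixes \<eta> :: "'a set"
  assumes "n \<ge> 1" and card: "\<And>\<eta>. \<eta> \<in> S \<Longrightarrow> card \<eta> = n + 1" and "card \<eta> = n + 1"
  shows "complex_dim (attachment n \<eta> (face_closure S)) = int n - 1
    \<longleftrightarrow> (\<exists>\<eta>'\<in>S. shares_facet n \<eta>' \<eta>)"
proof -
  define A where "A = attachment n \<eta> (face_closure S)"
  have A: "A = {\<tau>. \<tau> \<noteq> {} \<and> \<tau> \<subseteq> \<eta> \<and> (\<exists>\<eta>'\<in>S. \<eta>' \<noteq> \<eta> \<and> \<tau> \<subseteq> \<eta>')}"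
    unfolding A_def attachment_def using simplices_face_closure[OF card] by simp
  have fin\<eta>: "finite \<eta>" using assms(3) by (metis add_is_0 card.infinite one_neq_zero)
  have finA: "finite A" by (rule finite_subset[of _ "Pow \<eta>"]) (auto simp: A fin\<eta>)
  have le: "card \<tau> \<le> n" if \<tau>: "\<tau> \<in> A" for \<tau>
  proof -
    obtain \<eta>' where e: "\<eta>' \<in> S" "\<eta>' \<noteq> \<eta>" "\<tau> \<subseteq> \<eta>'" "\<tau> \<subseteq> \<eta>" using \<tau> A by auto
    have "finite \<eta>'" using card[OF e(1)] by (metis add_is_0 card.infinite one_neq_zero)
    then have "\<tau> \<noteq> \<eta>" using e card[OF e(1)] assms(3) by (metis card_subset_eq)
    then have "card \<tau> < card \<eta>" using e(4) fin\<eta> by (simp add: psubset_card_mono psubsetI)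
    then show ?thesis using assms(3) by simp
  qed
  have "complex_dim A = int n - 1 \<longleftrightarrow> (\<exists>\<tau>\<in>A. card \<tau> = n)"
  proof (cases "A = {}")
    \<comment> \<open>The empty complex has dimension -1, which differs from \<open>n - 1\<close> as
      \<open>n >= 1\<close>.\<close>
    case True
    then show ?thesis using assms(1) by (simp add: complex_dim_def)
  next
    case False
    then have "complex_dim A = int n - 1 \<longleftrightarrow> int n - 1 \<in> (\<lambda>\<sigma>. int (card \<sigma>) - 1) ` A"
      using finA by (subst complex_dim_def, simp add: Max_eq_iff) (use le in fastforce)
    then show ?thesis by auto
  qed
  also have "\<dots> \<longleftrightarrow> (\<exists>\<eta>'\<in>S. shares_facet n \<eta>' \<eta>)"
  proof -
    have "\<tau> \<noteq> {}" if "card \<tau> = n" for \<tau> :: "'a set" using that assms(1) by auto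
    then show ?thesis unfolding A shares_facet_def mem_Collect_eq bex_simps Bex_def by metis
  qed
  finally show ?thesis unfolding A_def .
qed

lemma has_ordering_iff_attaching_list:
  assumes "n \<ge> 1"
  shows "has_ordering n K \<longleftrightarrow>
    (\<exists>es. distinct es \<and> set es = simplices n K \<and> attaching_list (shares_facet n) es)"
proof -
  have eq: "(let A = attachment n (es ! (i - 1)) (face_closure (set (take i es)))
          in simplicial_complex (\<Union>A) A \<and> complex_dim A = int n - 1) \<longleftrightarrow>
        (\<exists>k<i - 1. shares_facet n (es ! k) (es ! (i - 1)))"
    if es: "set es = simplices n K" and i: "2 \<le> i" "i \<le> length es" for es i
  proof -
    have c: "card (es ! (i - 1)) = n + 1"
      using es i nth_mem[of "i - 1" es] by (auto simp: simplices_def)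
    then have f: "finite (es ! (i - 1))" by (metis add_is_0 card.infinite one_neq_zero)
    have "\<And>\<eta>. \<eta> \<in> set (take i es) \<Longrightarrow> card \<eta> = n + 1"
      using es by (auto simp: simplices_def dest!: in_set_takeD)
    note dim = complex_dim_attachment_iff[OF assms this c]
    have "(\<exists>\<eta>'\<in>set (take i es). shares_facet n \<eta>' (es ! (i - 1))) \<longleftrightarrow>
        (\<exists>k<i. shares_facet n (es ! k) (es ! (i - 1)))"
      using i by (auto simp: set_conv_nth)
    \<comment> \<open>\<open>take i es\<close> still contains \<open>es ! (i - 1)\<close> itself;
      this index drops out because \<open>shares_facet\<close> is irreflexive.\<close>
    also have "\<dots> \<longleftrightarrow> (\<exists>k<i - 1. shares_facet n (es ! k) (es ! (i - 1)))"
    proof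
      assume "\<exists>k<i. shares_facet n (es ! k) (es ! (i - 1))"
      then obtain k where k: "k < i" "shares_facet n (es ! k) (es ! (i - 1))" by blast
      then have "k \<noteq> i - 1" by (auto simp: shares_facet_def)
      then show "\<exists>k<i - 1. shares_facet n (es ! k) (es ! (i - 1))" using k by (intro exI[of _ k]) auto
    qed (meson less_imp_diff_less less_le_trans diff_le_self)
    finally show ?thesis using dim simplicial_complex_attachment[OF f] by (simp add: Let_def)
  qed
  have "(\<forall>i. 2 \<le> i \<and> i \<le> length es \<longrightarrow>
           (let A = attachment n (es ! (i - 1)) (face_closure (set (take i es)))
            in simplicial_complex (\<Union>A) A \<and> complex_dim A = int n - 1))
      \<longleftrightarrow> attaching_list (shares_facet n) es" (is "?L \<longleftrightarrow> _")
    if es: "set es = simplices n K" for es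
  proof
    assume L: ?L
    show "attaching_list (shares_facet n) es"
      unfolding attaching_list_def
    proof (intro allI impI, elim conjE)
      fix j assume j: "1 \<le> j" "j < length es"
      then have "2 \<le> j + 1" "j + 1 \<le> length es" by auto
      from eq[OF es this] L this show "\<exists>k<j. shares_facet n (es ! k) (es ! j)"
        by (metis add_diff_cancel_right')
    qed
  next
    assume a: "attaching_list (shares_facet n) es"
    show ?L
    proof (intro allI impI, elim conjE)
      fix i assume i: "2 \<le> i" "i \<le> length es"
      then have "1 \<le> i - 1" "i - 1 < length es" by auto
      then show "let A = attachment n (es ! (i - 1)) (face_closure (set (take i es)))
            in simplicial_complex (\<Union>A) A \<and> complex_dim A = int n - 1"
        using a eq[OF es i] unfolding attaching_list_def by blast
    qed
  qed
  then show ?thesis unfolding has_ordering_def by blast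
qed

section \<open>From paths to crossing pairs\<close>

text \<open>Needed because \<open>shares_facet\<close> mentions only sets of size \<open>n\<close>,
  not \<open>K\<close>: closure under non-empty faces puts the shared set into the complex.\<close>

lemma face_in_simplices:
  assumes "n \<ge> 1" "simplicial_complex V K" "\<eta> \<in> K" "\<sigma> \<subseteq> \<eta>" "card \<sigma> = n"
  shows "\<sigma> \<in> simplices (n - 1) K"
proof -
  have "\<sigma> \<noteq> {}" using assms(1,5) by auto
  then have "\<sigma> \<in> K" using assms(2-4) unfolding simplicial_complex_def by blast
  then show ?thesis using assms(1,5) by (simp add: simplices_def)
qed

text \<open>A set \<open>S\<close> without crossing pairs is closed under sharing a facet. A path
  from a facet of a member of \<open>S\<close> to a facet of an outside simplex then never leaves
  \<open>S\<close>, which pulls the outside simplex into \<open>S\<close>.\<close>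

lemma connected_complex_imp_cut_connected:
  assumes "n \<ge> 1" and K: "simplicial_complex V K" and conn: "connected_complex n K"
  shows "cut_connected (shares_facet n) (simplices n K)"
  unfolding cut_connected_def
proof (intro allI impI, elim conjE, rule ccontr)
  fix S assume S: "S \<subseteq> simplices n K" "S \<noteq> {}" "S \<noteq> simplices n K"
    and no: "\<not> (\<exists>x\<in>S. \<exists>y\<in>simplices n K - S. shares_facet n x y)"
  have closed: "\<eta>' \<in> S"
    if "\<eta> \<in> S" "\<eta>' \<in> simplices n K" "\<sigma> \<subseteq> \<eta>" "\<sigma> \<subseteq> \<eta>'" "card \<sigma> = n" for \<sigma> \<eta> \<eta>'
    using no that unfolding shares_facet_def by (metis DiffI)
  have face: "\<exists>\<sigma>\<in>simplices (n - 1) K. \<sigma> \<subseteq> \<eta> \<and> card \<sigma> = n" if "\<eta> \<in> simplices n K" for \<eta>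
  proof -
    have e: "\<eta> \<in> K" "card \<eta> = n + 1" using that by (auto simp: simplices_def)
    then obtain \<sigma> where "\<sigma> \<subseteq> \<eta>" "card \<sigma> = n" by (metis le_add1 obtain_subset_with_card_n)
    then show ?thesis using face_in_simplices[OF assms(1) K e(1)] by blast
  qed
  obtain \<eta> \<eta>' where e: "\<eta> \<in> S" "\<eta>' \<in> simplices n K" "\<eta>' \<notin> S" using S by blast
  obtain \<sigma> where s: "\<sigma> \<in> simplices (n - 1) K" "\<sigma> \<subseteq> \<eta>" "card \<sigma> = n" using face e S by blast
  obtain \<tau> where t: "\<tau> \<in> simplices (n - 1) K" "\<tau> \<subseteq> \<eta>'" "card \<tau> = n" using face e by blast
  \<comment> \<open>Equal facets are treated separately, since connectedness provides paths only
    between distinct ones.\<close>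
  have "\<exists>\<eta>\<in>S. \<tau> \<subseteq> \<eta>"
  proof (cases "\<sigma> = \<tau>")
    case True
    then show ?thesis using e s by blast
  next
    case False
    then obtain ss es where w: "walk_seq n K ss es" "hd ss = \<sigma>" "last ss = \<tau>"
      using conn s t unfolding connected_complex_def path_seq_def by blast
    have len: "length ss = length es + 1" using w by (simp add: walk_seq_def)
    \<comment> \<open>Invariant along the walk: \<open>es ! k\<close> shares \<open>ss ! k\<close>
      with a member of \<open>S\<close>, so it lies in \<open>S\<close> and covers the next
      face.\<close>
    have "\<exists>\<eta>\<in>S. ss ! k \<subseteq> \<eta>" if "k \<le> length es" for k
      using that
    proof (induction k)
      case 0
      have "ss ! 0 = \<sigma>" using w len by (metis Suc_eq_plus1 hd_conv_nth list.size(3) nat.simps(3))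
      then show ?case using e s by blast
    next
      case (Suc k)
      then obtain \<rho> where "\<rho> \<in> S" "ss ! k \<subseteq> \<rho>" by auto
      moreover have "ss ! k \<in> simplices (n - 1) K"
        using w Suc.prems len nth_mem[of k ss] unfolding walk_seq_def by auto
      moreover have "es ! k \<in> simplices n K" "ss ! k \<subseteq> es ! k" "ss ! Suc k \<subseteq> es ! k"
        using w Suc.prems nth_mem[of k es] unfolding walk_seq_def by auto
      moreover from calculation have "card (ss ! k) = n" using assms(1) by (simp add: simplices_def)
      ultimately show ?case using closed by blast
    qed
    moreover have "ss ! length es = \<tau>"
      using w len by (metis add_diff_cancel_right' last_conv_nth length_0_conv add_is_0 one_neq_zero)
    ultimately show ?thesis by blast
  qed
  then show False using closed e t by blast
qed

section \<open>From crossing pairs to paths\<close>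

lemma path_seq_take:
  assumes "path_seq n K ss es" and "0 < k" "k \<le> length es"
  shows "path_seq n K (take (k + 1) ss) (take k es)"
proof -
  have "set (take (k + 1) ss) \<subseteq> set ss" "set (take k es) \<subseteq> set es"
    by (rule set_take_subset)+
  then show ?thesis
    using assms unfolding path_seq_def walk_seq_def by (simp add: min_def) blast
qed

text \<open>Append \<eta> and \<rho>', first cutting the path back if one of them already occurs;
  this keeps all simplices distinct without a separate loop removal. The end \<rho>' must differ
  from the start, because a path contains at least one \<open>n\<close>-simplex.\<close>

lemma path_seq_extend:
  assumes n: "n \<ge> 1" and p: "path_seq n K ss es" "last ss = \<rho>"
    and e: "\<eta> \<in> simplices n K" "\<rho> \<subseteq> \<eta>" "\<rho>' \<subseteq> \<eta>" "\<rho>' \<in> simplices (n - 1) K"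
    and ne: "\<rho>' \<noteq> hd ss"
  shows "\<exists>ss' es'. path_seq n K ss' es' \<and> hd ss' = hd ss \<and> last ss' = \<rho>'"
proof -
  have len: "length ss = length es + 1" and w: "walk_seq n K ss es"
    and facts: "set ss \<subseteq> simplices (n - 1) K" "set es \<subseteq> simplices n K"
      "\<forall>k < length es. ss ! k \<noteq> ss ! (k + 1) \<and> ss ! k \<subseteq> es ! k \<and> ss ! (k + 1) \<subseteq> es ! k"
      "distinct ss" "distinct es"
    using p unfolding path_seq_def walk_seq_def by auto
  \<comment> \<open>The sizes \<open>n\<close> and \<open>n + 1\<close> differ, so distinctness only
    has to be checked within each of the two lists.\<close>
  have disj: "simplices (n - 1) K \<inter> simplices n K = {}"
    using n by (auto simp: simplices_def)
  \<comment> \<open>The conditions are listed singly instead of as \<open>path_seq\<close>, because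
    \<open>es1\<close> may be empty: this happens when \<eta> is the first \<open>n\<close>-simplex
    of the path.\<close>
  have snoc: "path_seq n K (ss1 @ [\<rho>']) (es1 @ [\<eta>])"
    if "length ss1 = length es1 + 1" "set ss1 \<subseteq> simplices (n - 1) K" "set es1 \<subseteq> simplices n K"
      "\<forall>k < length es1. ss1 ! k \<noteq> ss1 ! (k + 1) \<and> ss1 ! k \<subseteq> es1 ! k \<and> ss1 ! (k + 1) \<subseteq> es1 ! k"
      "distinct ss1" "distinct es1" "\<rho>' \<notin> set ss1" "\<eta> \<notin> set es1" "last ss1 \<subseteq> \<eta>" for ss1 es1
  proof -
    have ne: "ss1 \<noteq> []" using that(1) by auto
    then have l: "last ss1 = ss1 ! length es1" using that(1) by (simp add: last_conv_nth)
    have "walk_seq n K (ss1 @ [\<rho>']) (es1 @ [\<eta>])"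
      unfolding walk_seq_def
    proof (intro conjI allI impI)
      fix k assume "k < length (es1 @ [\<eta>])"
      then consider "k < length es1" | "k = length es1" by fastforce
      note c = this
      have mem: "ss1 ! length es1 \<in> set ss1" using that(1) by auto
      show "(ss1 @ [\<rho>']) ! k \<noteq> (ss1 @ [\<rho>']) ! (k + 1)"
        using c by cases (use that mem in \<open>auto simp: nth_append\<close>)
      show "(ss1 @ [\<rho>']) ! k \<subseteq> (es1 @ [\<eta>]) ! k"
        using c by cases (use that l in \<open>auto simp: nth_append\<close>)
      show "(ss1 @ [\<rho>']) ! (k + 1) \<subseteq> (es1 @ [\<eta>]) ! k"
        using c by cases (use that e in \<open>auto simp: nth_append\<close>)
    qed (use that e in auto)
    then show ?thesis
      using that e disj unfolding path_seq_def by auto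
  qed
  consider (old_face) "\<rho>' \<in> set ss" | (old_simplex) "\<rho>' \<notin> set ss" "\<eta> \<in> set es"
    | (new) "\<rho>' \<notin> set ss" "\<eta> \<notin> set es" by blast
  then show ?thesis
  proof cases
    \<comment> \<open>The path is stopped where it meets \<rho>'.\<close>
    case old_face
    then obtain k where k: "k < length ss" "ss ! k = \<rho>'" by (auto simp: in_set_conv_nth)
    have "0 < k" using k ne by (cases k) (auto simp: hd_conv_nth)
    then have "path_seq n K (take (k + 1) ss) (take k es)"
      using path_seq_take[OF p(1)] k len by auto
    moreover have "last (take (k + 1) ss) = \<rho>'" using k by (simp add: take_Suc_conv_app_nth)
    moreover have "hd (take (k + 1) ss) = hd ss" by (simp add: take_Suc hd_take)
    ultimately show ?thesis by blast
  next
    \<comment> \<open>The path is followed up to the face from which it enters \<eta>, then leaves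
      \<eta> through \<rho>'.\<close>
    case old_simplex
    then obtain k where k: "k < length es" "es ! k = \<eta>" by (auto simp: in_set_conv_nth)
    have t: "take (Suc k) es = take k es @ [\<eta>]" using k by (simp add: take_Suc_conv_app_nth)
    have "distinct (take (Suc k) es)" using p unfolding path_seq_def by auto
    then have "\<eta> \<notin> set (take k es)" unfolding t by auto
    moreover have "last (take (k + 1) ss) = ss ! k"
      using k len by (simp add: take_Suc_conv_app_nth)
    moreover have "ss ! k \<subseteq> \<eta>" using w k unfolding walk_seq_def by auto
    ultimately have "path_seq n K (take (k + 1) ss @ [\<rho>']) (take k es @ [\<eta>])"
      using k len facts old_simplex by (intro snoc) (auto dest: in_set_takeD)
    moreover have "hd (take (k + 1) ss @ [\<rho>']) = hd ss" using len by (cases ss) auto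
    ultimately show ?thesis by (metis last_snoc)
  next
    case new
    then have "path_seq n K (ss @ [\<rho>']) (es @ [\<eta>])"
      using len facts p(2) e by (intro snoc) auto
    moreover have "hd (ss @ [\<rho>']) = hd ss" using len by (cases ss) auto
    ultimately show ?thesis by (metis last_snoc)
  qed
qed

text \<open>The \<open>n\<close>-simplices with a face reachable from \<sigma> form a set that no
  adjacent pair leaves, so they are all \<open>n\<close>-simplices, including one above
  \<tau>.\<close>

lemma cut_connected_imp_connected_complex:
  assumes n: "n \<ge> 1" and pure: "pure_complex n V K"
    and cut: "cut_connected (shares_facet n) (simplices n K)"
  shows "connected_complex n K"
  unfolding connected_complex_def
proof (intro ballI impI)
  fix \<sigma> \<tau> assume s: "\<sigma> \<in> simplices (n - 1) K" and t: "\<tau> \<in> simplices (n - 1) K" and "\<sigma> \<noteq> \<tau>"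
  \<comment> \<open>The start \<sigma> is added by hand, since no path has length zero.\<close>
  define R where "R \<rho> \<longleftrightarrow> \<rho> = \<sigma> \<or> (\<exists>ss es. path_seq n K ss es \<and> hd ss = \<sigma> \<and> last ss = \<rho>)" for \<rho>
  \<comment> \<open>Reachability spreads to all facets of an \<open>n\<close>-simplex as soon as one
    facet is reachable.\<close>
  have step: "R \<rho>'"
    if R: "R \<rho>" and "\<rho> \<subseteq> \<eta>" "\<rho>' \<subseteq> \<eta>" "\<eta> \<in> simplices n K" "\<rho>' \<in> simplices (n - 1) K" for \<rho> \<rho>' \<eta>
  proof (cases "\<rho>' = \<sigma>")
    case True
    then show ?thesis by (simp add: R_def)
  next
    case ne: False
    show ?thesis
    proof (cases "\<rho> = \<sigma>")
      case True
      have "\<eta> \<noteq> \<sigma>" "\<eta> \<noteq> \<rho>'" using that s n by (auto simp: simplices_def)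
      then have "path_seq n K [\<sigma>, \<rho>'] [\<eta>]"
        using that True ne s unfolding path_seq_def walk_seq_def by auto
      then show ?thesis unfolding R_def by fastforce
    next
      case False
      then obtain ss es where "path_seq n K ss es" "hd ss = \<sigma>" "last ss = \<rho>"
        using R unfolding R_def by blast
      then show ?thesis using path_seq_extend[OF n _ _ that(4,2,3,5)] ne unfolding R_def by metis
    qed
  qed
  have above: "\<exists>\<eta>\<in>simplices n K. \<rho> \<subseteq> \<eta>" if "\<rho> \<in> simplices (n - 1) K" for \<rho>
    using pure that unfolding pure_complex_def by (auto simp: simplices_def)
  define S where "S = {\<eta> \<in> simplices n K. \<exists>\<rho>. R \<rho> \<and> \<rho> \<subseteq> \<eta>}"
  have "S = simplices n K"
  proof (rule ccontr)
    assume "S \<noteq> simplices n K"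
    moreover have "S \<noteq> {}" using above[OF s] unfolding S_def R_def by blast
    moreover have "S \<subseteq> simplices n K" unfolding S_def by blast
    ultimately obtain \<eta> \<eta>' where e: "\<eta> \<in> S" "\<eta>' \<in> simplices n K - S" "shares_facet n \<eta> \<eta>'"
      using cut unfolding cut_connected_def by blast
    then obtain \<rho>' where r: "card \<rho>' = n" "\<rho>' \<subseteq> \<eta>" "\<rho>' \<subseteq> \<eta>'" unfolding shares_facet_def by blast
    have "\<eta>' \<in> K" using e by (simp add: simplices_def)
    then have "\<rho>' \<in> simplices (n - 1) K"
      using face_in_simplices[OF n _ _ r(3,1)] pure unfolding pure_complex_def by blast
    \<comment> \<open>The common facet is reached inside \<eta>; as it also lies in \<eta>', it
      would put \<eta>' into \<open>S\<close>.\<close>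
    then have "R \<rho>'" using step e r unfolding S_def by blast
    then show False using e r unfolding S_def by blast
  qed
  moreover obtain \<eta> where "\<eta> \<in> simplices n K" "\<tau> \<subseteq> \<eta>" using above[OF t] by blast
  ultimately have "R \<tau>" using step t unfolding S_def by blast
  then show "\<exists>ss es. path_seq n K ss es \<and> hd ss = \<sigma> \<and> last ss = \<tau>"
    using \<open>\<sigma> \<noteq> \<tau>\<close> unfolding R_def by blast
qed

theorem theorem3p1:
  fixes n :: nat and V :: "'a set" and K :: "'a set set"
  assumes "n \<ge> 1" and "pure_complex n V K"
  shows "connected_complex n K \<longleftrightarrow> has_ordering n K"
proof -
  have K: "simplicial_complex V K" using assms(2) by (simp add: pure_complex_def)
  have "finite (simplices n K)"
    by (rule finite_subset[of _ "Pow V"]) (use K in \<open>auto simp: simplicial_complex_def simplices_def\<close>)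
  then have "cut_connected (shares_facet n) (simplices n K) \<longleftrightarrow> has_ordering n K"
    unfolding has_ordering_iff_attaching_list[OF assms(1)]
    by (metis attaching_list_imp_cut_connected cut_connected_imp_attaching_list shares_facet_sym)
  then show ?thesis
    using connected_complex_imp_cut_connected[OF assms(1) K]
      cut_connected_imp_connected_complex[OF assms] by blast
qed

end
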